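(* Let $A$ be a real $m\times n$ matrix with no zero rows, let $b\in\mathbb{R}^m$, and let $u=Fb$. Suppose that $Ax=b$ is consistent and $A$ is reflection consistent. Then for any $x\in\mathbb{R}^n$, we have $Ax=b$ if and only if $(I_n-R_A)x=u$.
   Context: $A_i^{T}$ denotes the $i$-th row of $A$ (so $A_i$ is a column vector), $\|\cdot\|$ is the Euclidean norm, and $e_1,\ldots,e_m$ is the standard basis of $\mathbb{R}^m$. Let $R_i=I_n-2\frac{A_iA_i^{T}}{\|A_i\|^2}$ and $R_A=R_m\cdots R_2R_1$. The $n\times m$ matrix $F$ is $F=\sum_{j=1}^m\frac{2}{\|A_j\|^2}R_m\cdots R_{j+1}A_je_j^{T}$, where $R_m\cdots R_{j+1}$ is the identity matrix when $j=m$. Reflection consistency: let $r$ be the rank of $A$ and let $a_1^{T},\ldots,a_r^{T}$ be $r$ linearly independent rows of $A$; $A$ is called reflection consistent if $R_A$ and $\prod_{i=1}^r\big(I_n-2\frac{a_ia_i^{T}}{\|a_i\|^2}\big)$ have the same eigenspace corresponding to the eigenvalue $1$ (this does not depend on the choice of $a_1,\ldots,a_r$). *)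

theory Defs
  imports "HOL-Analysis.Analysis"
begin

text \<open>
  The order in which the rows are processed matters, so the row index type \<open>'m\<close> carries a linear
  order; \<open>i < j\<close> means that the \<open>i\<close>-th row precedes the \<open>j\<close>-th row.
  Every finite type can be given such an order, and the numeral types come with one.
\<close>

definition reflection :: "real^'n \<Rightarrow> real^'n^'n" where
  "reflection a = mat 1 - (2 / (norm a)\<^sup>2) *\<^sub>R ((columnvector a :: real^1^'n) ** rowvector a)"

text \<open>The product is taken from left to right: \<open>[a, b, c]\<close> yields
  \<open>reflection a ** reflection b ** reflection c\<close>.\<close>

definition reflection_product :: "(real^'n) list \<Rightarrow> real^'n^'n" where
  "reflection_product vs = foldr (\<lambda>a M. reflection a ** M) vs (mat 1)"

text \<open>The rows with index in \<open>I\<close>, in decreasing order of the index: applying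
  \<open>reflection_product\<close> makes the reflection for the first row the rightmost factor.\<close>

definition rows_desc :: "real^'n^('m::{finite,linorder}) \<Rightarrow> 'm set \<Rightarrow> (real^'n) list" where
  "rows_desc A I = map (\<lambda>i. row i A) (rev (sorted_list_of_set I))"

definition R_mat :: "real^'n^('m::{finite,linorder}) \<Rightarrow> real^'n^'n" where
  "R_mat A = reflection_product (rows_desc A UNIV)"

definition F_mat :: "real^'n^('m::{finite,linorder}) \<Rightarrow> real^('m::{finite,linorder})^'n" where
  "F_mat A = (\<Sum>j\<in>UNIV. (2 / (norm (row j A))\<^sup>2) *\<^sub>R
     (reflection_product (rows_desc A {j<..}) **
      (columnvector (row j A) :: real^1^'n) ** rowvector (axis j 1)))"

definition eigenspace :: "real^'n^'n \<Rightarrow> real \<Rightarrow> (real^'n) set" where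
  "eigenspace M c = {x. M *v x = c *\<^sub>R x}"

text \<open>The condition on the eigenspaces does not depend on the choice of the list \<open>vs\<close>: for
  linearly independent vectors, the vectors fixed by the product of the reflections are exactly
  those orthogonal to all of the vectors, and the lists admitted here all span the row space.
  As \<open>vs\<close> enumerates its elements in any order, no convention on the order of the product of the
  \<open>r\<close> reflections is built in.\<close>

definition reflection_consistent :: "real^'n^('m::{finite,linorder}) \<Rightarrow> bool" where
  "reflection_consistent A \<longleftrightarrow>
     (\<exists>vs. set vs \<subseteq> rows A \<and> distinct vs \<and> independent (set vs) \<and> length vs = rank A \<and>
           eigenspace (R_mat A) 1 = eigenspace (reflection_product vs) 1)"

end

theory Submission
  imports Defs
begin

text \<open>
  Telescoping the product of the reflections gives \<open>F A = I - R\<^sub>A\<close>, so \<open>u = (I - R\<^sub>A) x\<^sub>0\<close> for any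
  solution \<open>x\<^sub>0\<close> of \<open>A x\<^sub>0 = b\<close>. Hence \<open>(I - R\<^sub>A) x = u\<close> says that \<open>x - x\<^sub>0\<close> is fixed by \<open>R\<^sub>A\<close>,
  equivalently, by reflection consistency, by a product of reflections in linearly independent rows
  that span the row space. Each such reflection moves a point along its own row, so by independence
  a fixed vector of the product is orthogonal to all these rows, that is, \<open>A (x - x\<^sub>0) = 0\<close>.
\<close>

lemma columnvector_rowvector_mult:
  "((columnvector a :: real^1^'n) ** rowvector c) *v x = (c \<bullet> x) *\<^sub>R a"
  by (simp add: vec_eq_iff matrix_vector_mult_def matrix_matrix_mult_def columnvector_def
      rowvector_def inner_vec_def sum_distrib_left mult_ac)

lemma reflection_mult:
  "reflection a *v x = x - (2 / (norm a)\<^sup>2 * (a \<bullet> x)) *\<^sub>R a"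
  by (simp add: reflection_def matrix_vector_mult_diff_rdistrib scaleR_matrix_vector_assoc [symmetric]
      columnvector_rowvector_mult)

lemma reflection_product_Nil_mult [simp]: "reflection_product [] *v x = x"
  by (simp add: reflection_product_def)

lemma reflection_product_Cons_mult [simp]:
  "reflection_product (a # vs) *v x = reflection a *v (reflection_product vs *v x)"
  by (simp add: reflection_product_def matrix_vector_mul_assoc)

lemma reflection_product_append_mult:
  "reflection_product (vs @ ws) *v x = reflection_product vs *v (reflection_product ws *v x)"
  by (induction vs) simp_all

text \<open>Each factor moves the current point by a multiple of its own vector, so the total
  displacement is a combination of the listed vectors.\<close>

lemma diff_reflection_product_in_span:
  "x - reflection_product vs *v x \<in> span (set vs)"
proof (induction vs)
  case Nil
  then show ?case by simp
next
  case (Cons a vs)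
  let ?y = "reflection_product vs *v x"
  have "x - ?y \<in> span (set (a # vs))"
    using Cons.IH span_mono[OF set_subset_Cons] by blast
  \<comment> \<open>The added multiple of \<open>a\<close> is the displacement caused by the
    outermost reflection, which acts on \<open>?y\<close>.\<close>
  then have "(x - ?y) + (2 / (norm a)\<^sup>2 * (a \<bullet> ?y)) *\<^sub>R a \<in> span (set (a # vs))"
    by (rule span_add) (simp add: span_base span_scale)
  then show ?case
    by (simp add: reflection_mult algebra_simps)
qed

text \<open>Induction peels off the outermost reflection. Its displacement must undo that of all
  earlier ones, which lies in the span of the other vectors; independence makes both vanish, so the
  shorter product fixes \<open>x\<close> as well.\<close>

lemma reflection_product_fixed_orthogonal:
  assumes "distinct vs" "independent (set vs)" "reflection_product vs *v x = x" "v \<in> set vs"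
  shows "v \<bullet> x = 0"
  using assms
proof (induction vs)
  case Nil
  then show ?case by simp
next
  case (Cons a vs)
  define y where "y = reflection_product vs *v x"
  define c where "c = 2 / (norm a)\<^sup>2 * (a \<bullet> y)"
  have a: "a \<notin> span (set vs)" and ind: "independent (set vs)"
    using Cons.prems independent_insert[of a "set vs"] by auto
  have "a \<noteq> 0"
    using a span_zero by blast
  have "y - c *\<^sub>R a = x"
    using Cons.prems(3) by (simp add: y_def c_def reflection_mult)
  then have ca: "- c *\<^sub>R a = x - y"
    by (simp add: algebra_simps)
  have "- c *\<^sub>R a \<in> span (set vs)"
    unfolding ca y_def by (rule diff_reflection_product_in_span)
  \<comment> \<open>Otherwise scaling by \<open>- inverse c\<close> would put \<open>a\<close>
    itself into the span of the remaining vectors.\<close>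
  then have "c = 0"
    using a span_scale[of "- c *\<^sub>R a" "set vs" "- inverse c"] by (cases "c = 0") auto
  then have "y = x"
    using ca by simp
  moreover have "a \<bullet> x = 0"
    using \<open>c = 0\<close> \<open>a \<noteq> 0\<close> \<open>y = x\<close> by (simp add: c_def)
  ultimately show ?case
    using Cons.IH Cons.prems ind by (auto simp: y_def)
qed

text \<open>The smallest index gives the rightmost factor, that is, the reflection that acts
  first.\<close>

lemma rows_desc_insert_min:
  assumes "finite I" "\<And>i. i \<in> I \<Longrightarrow> k < i"
  shows "rows_desc A (insert k I) = rows_desc A I @ [row k A]"
proof -
  have "k \<notin> I"
    using assms(2) by blast
  then have "sorted_list_of_set (insert k I) = k # sorted_list_of_set I"
    using assms by (simp add: insort_is_Cons less_imp_le)
  then show ?thesis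
    by (simp add: rows_desc_def)
qed

text \<open>This is the telescoping, stated for an arbitrary finite index set so that induction can
  insert ever smaller indices. The vector subtracted by reflection \<open>j\<close> is carried along
  by all reflections that act later.\<close>

lemma reflection_product_rows_desc_mult:
  fixes A :: "real^'n^'m::{finite,linorder}"
  assumes "finite I"
  shows "reflection_product (rows_desc A I) *v x =
    x - (\<Sum>j\<in>I. (2 / (norm (row j A))\<^sup>2 * (row j A \<bullet> x)) *\<^sub>R
      (reflection_product (rows_desc A {i \<in> I. j < i}) *v row j A))"
  using assms
proof (induction I rule: finite_linorder_min_induct)
  case empty
  then show ?case by (simp add: rows_desc_def)
next
  case (insert k I)
  let ?c = "\<lambda>j. 2 / (norm (row j A))\<^sup>2 * (row j A \<bullet> x)"
  let ?P = "\<lambda>J. reflection_product (rows_desc A J)"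
  have k: "k \<notin> I"
    using insert by blast
  \<comment> \<open>All of \<open>I\<close> comes after the new minimum \<open>k\<close>, while
    \<open>k\<close> comes after no index in \<open>I\<close>; the old summands are therefore
    unchanged.\<close>
  have "{i \<in> insert k I. k < i} = I"
    using insert by auto
  moreover have "{i \<in> insert k I. j < i} = {i \<in> I. j < i}" if "j \<in> I" for j
    using insert that by force
  ultimately have "(\<Sum>j\<in>insert k I. ?c j *\<^sub>R (?P {i \<in> insert k I. j < i} *v row j A)) =
      ?c k *\<^sub>R (?P I *v row k A) + (\<Sum>j\<in>I. ?c j *\<^sub>R (?P {i \<in> I. j < i} *v row j A))"
    using insert k by simp
  \<comment> \<open>Reflection \<open>k\<close> acts first, hence on \<open>x\<close> itself, so its
    coefficient involves \<open>x\<close> and no intermediate point.\<close>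
  moreover have "?P (insert k I) *v x = ?P I *v x - ?c k *\<^sub>R (?P I *v row k A)"
    using insert by (simp add: rows_desc_insert_min reflection_product_append_mult
        reflection_mult matrix_vector_mult_diff_distrib matrix_vector_mult_scaleR)
  ultimately show ?case
    using insert.IH by simp
qed

lemma sum_matrix_vector_mult:
  fixes M :: "'i \<Rightarrow> real^'n^'m"
  shows "(\<Sum>i\<in>I. M i) *v x = (\<Sum>i\<in>I. M i *v x)"
  by (induction I rule: infinite_finite_induct) (simp_all add: matrix_vector_mult_add_rdistrib)

lemma F_mat_mult:
  fixes A :: "real^'n^'m::{finite,linorder}"
  shows "F_mat A *v (A *v x) = (mat 1 - R_mat A) *v x"
proof -
  \<comment> \<open>The factor \<open>rowvector (axis j 1)\<close> reads off entry \<open>j\<close>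
    of \<open>A *v x\<close>, which is the inner product of row \<open>j\<close> with
    \<open>x\<close>. This matches the summands of \<open>F_mat\<close> with those of the telescoped
    sum.\<close>
  have *: "(M ** ((columnvector a :: real^1^'n) ** rowvector (axis j 1))) *v (A *v x) =
      (row j A \<bullet> x) *\<^sub>R (M *v a)" for M :: "real^'n^'n" and a j
    by (simp add: matrix_vector_mul_assoc [of M, symmetric] columnvector_rowvector_mult
        matrix_vector_mult_scaleR inner_axis' matrix_vector_mul_component row_def)
  have "F_mat A *v (A *v x) = (\<Sum>j\<in>UNIV. (2 / (norm (row j A))\<^sup>2 * (row j A \<bullet> x)) *\<^sub>R
      (reflection_product (rows_desc A {j<..}) *v row j A))"
    unfolding F_mat_def sum_matrix_vector_mult
    by (intro sum.cong refl)
      (simp add: scaleR_matrix_vector_assoc [symmetric] matrix_mul_assoc [symmetric] * )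
  then show ?thesis
    by (simp add: R_mat_def reflection_product_rows_desc_mult matrix_vector_mult_diff_rdistrib
        greaterThan_def)
qed

lemma reflection_consistent_fixed_imp_kernel:
  fixes A :: "real^'n^'m::{finite,linorder}"
  assumes "reflection_consistent A" "R_mat A *v x = x"
  shows "A *v x = 0"
proof -
  obtain vs where vs: "set vs \<subseteq> rows A" "distinct vs" "independent (set vs)"
      "length vs = rank A" "eigenspace (R_mat A) 1 = eigenspace (reflection_product vs) 1"
    using assms(1) unfolding reflection_consistent_def by blast
  have "reflection_product vs *v x = x"
    using assms(2) vs(5) unfolding eigenspace_def by auto
  then have orth: "orthogonal x v" if "v \<in> set vs" for v
    using reflection_product_fixed_orthogonal[OF vs(2,3) _ that, of x]
    by (simp add: orthogonal_def inner_commute)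
  \<comment> \<open>The independent set lies in \<open>rows A\<close> and has as many elements as
    the row rank, so it spans all rows.\<close>
  have "dim (rows A) \<le> card (set vs)"
    using vs(2,4) by (simp add: distinct_card row_rank_def)
  then have "rows A \<subseteq> span (set vs)"
    using card_ge_dim_independent vs(1,3) by blast
  then have "orthogonal x (row i A)" for i
    using orthogonal_to_span[of "row i A" "set vs" x] orth by (auto simp: rows_def)
  then show ?thesis
    by (simp add: vec_eq_iff matrix_vector_mul_component row_def orthogonal_def inner_commute)
qed

theorem proposition24:
  fixes A :: "real^'n^'m::{finite,linorder}" and b :: "real^'m::{finite,linorder}" and u :: "real^'n"
  assumes "\<And>i. row i A \<noteq> 0"
    and "u = F_mat A *v b"
    and "\<exists>x. A *v x = b"
    and "reflection_consistent A"
  shows "\<forall>x. A *v x = b \<longleftrightarrow> (mat 1 - R_mat A) *v x = u"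
proof (intro allI iffI)
  fix x
  assume "A *v x = b"
  then show "(mat 1 - R_mat A) *v x = u"
    using assms(2) F_mat_mult by metis
next
  fix x
  assume x: "(mat 1 - R_mat A) *v x = u"
  obtain z where z: "A *v z = b"
    using assms(3) by blast
  then have "(mat 1 - R_mat A) *v (x - z) = 0"
    using x assms(2) F_mat_mult[of A z] by (simp add: matrix_vector_mult_diff_distrib)
  then have "A *v (x - z) = 0"
    using reflection_consistent_fixed_imp_kernel[OF assms(4)]
    by (simp add: matrix_vector_mult_diff_rdistrib)
  then show "A *v x = b"
    using z by (simp add: matrix_vector_mult_diff_distrib)
qed

end
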